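(* There is an absolute constant $C>0$ such that for all integers $k\geq2$, \[ \lceil C\cdot 1073^{k/6}\rceil\nrightarrow(3)^2_k. \]
   Context: For $m\in\mathbb N$ write $[m]=\{0,\dots,m-1\}$. For $n\geq 3$, $k\geq 2$, the relation $n\to(3)_k^2$ means that every colouring of the edges of the complete graph on $[n]$ with $k$ colours contains a monochromatic triangle; $n\nrightarrow(3)_k^2$ is its negation. *)

theory Defs
  imports Complex_Main
begin

definition edge_colouring :: "nat \<Rightarrow> nat \<Rightarrow> (nat set \<Rightarrow> nat) \<Rightarrow> bool" where
  "edge_colouring n k c \<longleftrightarrow>
     (\<forall>e. e \<subseteq> {..<n} \<and> card e = 2 \<longrightarrow> c e < k)"

definition has_mono_triangle :: "nat \<Rightarrow> (nat set \<Rightarrow> nat) \<Rightarrow> bool" where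
  "has_mono_triangle n c \<longleftrightarrow>
     (\<exists>x y z. x < n \<and> y < n \<and> z < n \<and> x \<noteq> y \<and> y \<noteq> z \<and> x \<noteq> z \<and>
        c {x, y} = c {y, z} \<and> c {x, y} = c {x, z})"

definition arrows_triangle :: "nat \<Rightarrow> nat \<Rightarrow> bool" where
  "arrows_triangle n k \<longleftrightarrow>
     (\<forall>c. edge_colouring n k c \<longrightarrow> has_mono_triangle n c)"

end

(* A sum-free colouring of {1..N} yields a triangle-free colouring of the complete graph on
   N + 1 vertices (colour the edge {i, j} by the distance of i and j), so it suffices to
   colour 33^((k - 1) div 3) integers with k colours: 33^2 = 1089 exceeds 1073.
   Three extra colours multiply the length by 33, by means of a Rowley template.  Three residue
   classes modulo 33 that are sum-free modulo 33 receive the new colours.  On the remaining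
   class, the representatives in {1..33} are sum-free as integers; hence a sum x + y = z within
   it carries over modulo 33, so that ceil(x/33) + ceil(y/33) = ceil(z/33), and the class can
   be coloured by the old colour of ceil(x/33). *)

theory Submission
  imports Defs
begin

text \<open>The case \<open>x = y\<close> is included because three equally spaced vertices of a
  triangle have two equal gaps.\<close>

definition sum_free_colouring :: "nat \<Rightarrow> nat \<Rightarrow> (nat \<Rightarrow> nat) \<Rightarrow> bool" where
  "sum_free_colouring N k c \<longleftrightarrow>
     (\<forall>x\<in>{1..N}. c x < k) \<and>
     (\<forall>x\<ge>1. \<forall>y\<ge>1. x + y \<le> N \<longrightarrow> \<not> (c x = c y \<and> c y = c (x + y)))"

lemma not_arrows_triangle_if_sum_free_colouring:
  assumes c: "sum_free_colouring N k c" and "n \<le> Suc N"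
  shows "\<not> arrows_triangle n k"
proof -
  define d where "d = (\<lambda>e::nat set. c (Max e - Min e))"
  have d_pair: "d {x, y} = c (y - x)" "d {y, x} = c (y - x)" if "x < y" for x y
    using that by (simp_all add: d_def max_def min_def)
  have "edge_colouring n k d"
    unfolding edge_colouring_def
  proof (intro allI impI)
    fix e :: "nat set"
    assume e: "e \<subseteq> {..<n} \<and> card e = 2"
    then obtain x y where xy: "e = {x, y}" "x < y"
      by (metis card_2_iff insert_commute linorder_neqE_nat)
    then have "y - x \<in> {1..N}"
      using e \<open>n \<le> Suc N\<close> by auto
    then show "d e < k"
      using c xy by (simp add: d_pair sum_free_colouring_def)
  qed
  moreover have "\<not> has_mono_triangle n d"
  proof
    \<comment> \<open>Both gaps of a sorted triple add up to the outer distance, so a monochromatic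
      triangle is a monochromatic sum. Edges are unordered, so the other vertex orders reduce to
      this one.\<close>
    have no_sorted: False
      if "x < y" "y < z" "z < n" "d {x, y} = d {y, z}" "d {x, y} = d {x, z}" for x y z
    proof -
      have "1 \<le> y - x" "1 \<le> z - y" "(y - x) + (z - y) = z - x" "z - x \<le> N"
        using that \<open>n \<le> Suc N\<close> by auto
      moreover have "c (y - x) = c (z - y)" "c (z - y) = c (z - x)"
        using that by (simp_all add: d_pair)
      ultimately show False
        using c unfolding sum_free_colouring_def by metis
    qed
    assume "has_mono_triangle n d"
    then obtain x y z where lt: "x < n" "y < n" "z < n"
      and ne: "x \<noteq> y" "y \<noteq> z" "x \<noteq> z"
      and eq: "d {x, y} = d {y, z}" "d {x, y} = d {x, z}"
      unfolding has_mono_triangle_def by blast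
    have comm: "d {a, b} = d {b, a}" for a b
      by (simp add: insert_commute)
    consider "x < y" "y < z" | "x < z" "z < y" | "y < x" "x < z"
      | "y < z" "z < x" | "z < x" "x < y" | "z < y" "y < x"
      using ne by linarith
    then show False
      by cases (use lt eq no_sorted comm in metis)+
  qed
  ultimately show ?thesis
    unfolding arrows_triangle_def by blast
qed

(* The residue of x in {1..p} is represented by (x - 1) mod p, whence the shifted sum a + b + 1;
   the colour m marks the class that is sum-free only as a set of integers. *)
lemma sum_free_colouring_template:
  fixes t :: "nat \<Rightarrow> nat"
  assumes c: "sum_free_colouring N k c" and "0 < p"
    and range: "\<And>a. a < p \<Longrightarrow> t a \<le> m"
    and template: "\<And>a b. a < p \<Longrightarrow> b < p \<Longrightarrow> t a = t b \<Longrightarrow> t b = t ((a + b + 1) mod p)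
      \<Longrightarrow> t a = m \<and> p \<le> a + b + 1"
  shows "sum_free_colouring (p * N) (m + k)
    (\<lambda>x. if t ((x - 1) mod p) < m then t ((x - 1) mod p) else m + c ((x - 1) div p + 1))"
    (is "sum_free_colouring _ _ ?d")
  unfolding sum_free_colouring_def
proof (intro conjI ballI allI impI notI)
  fix x assume x: "x \<in> {1..p * N}"
  then have "x - 1 < N * p"
    by (cases x) (simp_all add: mult.commute)
  then have "(x - 1) div p < N"
    using \<open>0 < p\<close> by (simp add: div_less_iff_less_mult)
  then have "c ((x - 1) div p + 1) < k"
    using c by (simp add: sum_free_colouring_def)
  then show "?d x < m + k"
    by simp
next
  fix x y assume x: "1 \<le> x" and y: "1 \<le> y" and le: "x + y \<le> p * N"
    and eq: "?d x = ?d y \<and> ?d y = ?d (x + y)"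
  define a u where "a = (x - 1) mod p" and "u = (x - 1) div p"
  define b v where "b = (y - 1) mod p" and "v = (y - 1) div p"
  have ab: "a < p" "b < p"
    using \<open>0 < p\<close> by (simp_all add: a_def b_def)
  have "x - 1 = p * u + a" "y - 1 = p * v + b"
    by (simp_all add: a_def u_def b_def v_def)
  then have sum: "x + y - 1 = p * (u + v) + (a + b + 1)"
    using x y by (simp add: algebra_simps)
  then have sum_mod: "(x + y - 1) mod p = (a + b + 1) mod p"
    by simp
  define s where "s = (a + b + 1) mod p"
  have t_le: "t a \<le> m" "t b \<le> m" "t s \<le> m"
    using range ab \<open>0 < p\<close> by (simp_all add: s_def)
  have eqs:
    "(if t a < m then t a else m + c (u + 1)) = (if t b < m then t b else m + c (v + 1))"
    "(if t b < m then t b else m + c (v + 1)) =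
       (if t s < m then t s else m + c ((x + y - 1) div p + 1))"
    using eq unfolding sum_mod s_def a_def b_def u_def v_def by auto
  \<comment> \<open>New colours lie below \<open>m\<close> and old ones are shifted to at least
    \<open>m\<close>, so the two kinds never agree.\<close>
  then have "t a = t b" "t b = t s"
    using t_le by (auto split: if_splits)
  then have ta: "t a = m" and wrap: "p \<le> a + b + 1"
    using template ab by (auto simp: s_def)
  \<comment> \<open>The wrap yields exactly one carry. It makes the quotients, once counted from 1,
    additive: \<open>u + 1\<close> and \<open>v + 1\<close> sum to the quotient of
    \<open>x + y\<close>.\<close>
  have "x + y - 1 = p * (u + v + 1) + (a + b + 1 - p)"
    using sum wrap by (simp add: algebra_simps)
  moreover have "a + b + 1 - p < p"
    using ab by linarith
  ultimately have quot: "(x + y - 1) div p = u + v + 1"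
    by (metis add.right_neutral div_less div_mult_self4 gr_implies_not0 add.commute)
  have "x + y - 1 < N * p"
    using x le by (simp add: mult.commute)
  then have "u + v + 1 < N"
    using quot \<open>0 < p\<close> by (metis div_less_iff_less_mult)
  then have "(u + 1) + (v + 1) \<le> N"
    by simp
  moreover have "c (u + 1) = c (v + 1) \<and> c (v + 1) = c ((u + 1) + (v + 1))"
    using eqs ta \<open>t a = t b\<close> \<open>t b = t s\<close> quot by simp
  ultimately show False
    using c unfolding sum_free_colouring_def
    by (metis le_add2)
qed

text \<open>Entry \<open>a\<close> belongs to the residue of \<open>a + 1\<close>. Class 3 contains
  33 itself, which is 0 modulo 33, so this class cannot be sum-free modulo 33.\<close>

definition rowley_template :: "nat list" where
  "rowley_template =
    [0, 1, 0, 3, 3, 1, 0, 2, 1, 1, 0, 3, 1, 3, 3, 0, 2,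
    2, 2, 2, 0, 3, 3, 1, 3, 0, 1, 1, 2, 0, 1, 3, 3]"

lemma rowley_template_le:
  "\<forall>a<33. rowley_template ! a \<le> 3"
  by (simp add: rowley_template_def All_less_Suc numeral_eq_Suc)

lemma rowley_template_sum_free:
  "\<forall>a<33. \<forall>b<33. rowley_template ! a = rowley_template ! b \<longrightarrow>
      rowley_template ! b = rowley_template ! ((a + b + 1) mod 33) \<longrightarrow>
      rowley_template ! a = 3 \<and> 33 \<le> a + b + 1"
proof -
  \<comment> \<open>Quantifiers over explicit lists let simplification evaluate all 33 * 33
    pairs.\<close>
  have "list_all (\<lambda>a. list_all (\<lambda>b. rowley_template ! a = rowley_template ! b \<longrightarrow>
      rowley_template ! b = rowley_template ! ((a + b + 1) mod 33) \<longrightarrow>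
      rowley_template ! a = 3 \<and> 33 \<le> a + b + 1) [0..<33]) [0..<33]"
    by (simp add: rowley_template_def upt_rec[of 0] upt_rec[of "Suc 0"] flip: numeral_2_eq_2)
  then show ?thesis
    by (simp add: list_all_iff)
qed

lemma sum_free_colouring_power_33:
  assumes "1 \<le> k"
  shows "\<exists>c. sum_free_colouring (33 ^ ((k - 1) div 3)) k c"
  using assms
proof (induction k rule: less_induct)
  case (less k)
  show ?case
  proof (cases "k \<le> 3")
    case True
    \<comment> \<open>The exponent is 0 here, and {1} contains no sum of two positive
      integers.\<close>
    then have "sum_free_colouring (33 ^ ((k - 1) div 3)) k (\<lambda>_. 0)"
      using less.prems by (simp add: sum_free_colouring_def)
    then show ?thesis
      by blast
  next
    case False
    then obtain c where c: "sum_free_colouring (33 ^ ((k - 3 - 1) div 3)) (k - 3) c"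
      using less.IH[of "k - 3"] by fastforce
    have "(k - 1) div 3 = Suc ((k - 3 - 1) div 3)"
      using False by presburger
    then have "33 * 33 ^ ((k - 3 - 1) div 3) = (33::nat) ^ ((k - 1) div 3)" and "3 + (k - 3) = k"
      using False by simp_all
    then show ?thesis
      using sum_free_colouring_template[OF c, of 33 "(!) rowley_template" 3]
        rowley_template_le rowley_template_sum_free by auto
  qed
qed

text \<open>Since 1073 is at most 33^2, the left power is at most 33^(k/3). The factor 1/33 pays for
  rounding the exponent down, a loss of at most 1.\<close>

lemma powr_1073_le_power_33:
  assumes "1 \<le> k"
  shows "1 / 33 * 1073 powr (real k / 6) \<le> 33 ^ ((k - 1) div 3)"
proof -
  have "k \<le> 3 * ((k - 1) div 3) + 3"
    using assms by presburger
  then have "real k / 3 \<le> real ((k - 1) div 3) + 1"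
    by linarith
  have "1073 powr (real k / 6) \<le> (33 powr 2) powr (real k / 6)"
    by (intro powr_mono2) auto
  also have "\<dots> = 33 powr (real k / 3)"
    by (subst powr_powr) simp
  also have "\<dots> \<le> 33 powr (real ((k - 1) div 3) + 1)"
    using \<open>real k / 3 \<le> _\<close> by simp
  also have "\<dots> = 33 * 33 ^ ((k - 1) div 3)"
    by (simp add: powr_add powr_realpow)
  finally show ?thesis
    by simp
qed

theorem theoremB1:
  shows "\<exists>C::real. C > 0 \<and>
     (\<forall>k::nat. k \<ge> 2 \<longrightarrow>
        \<not> arrows_triangle (nat \<lceil>C * 1073 powr (real k / 6)\<rceil>) k)"
proof (intro exI[of _ "1 / 33"] conjI allI impI)
  fix k :: nat
  assume "2 \<le> k"
  then obtain c where c: "sum_free_colouring (33 ^ ((k - 1) div 3)) k c"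
    using sum_free_colouring_power_33[of k] by auto
  have "1 / 33 * 1073 powr (real k / 6) \<le> real (33 ^ ((k - 1) div 3))"
    using powr_1073_le_power_33[of k] \<open>2 \<le> k\<close> by simp
  then have "nat \<lceil>1 / 33 * 1073 powr (real k / 6)\<rceil> \<le> 33 ^ ((k - 1) div 3)"
    using nat_ceiling_le_eq by blast
  then show "\<not> arrows_triangle (nat \<lceil>1 / 33 * 1073 powr (real k / 6)\<rceil>) k"
    by (intro not_arrows_triangle_if_sum_free_colouring[OF c] le_SucI)
qed simp

end
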